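(* Let $Q_1$, $Q_2$ and $P_3$ be non-constant complex polynomials, and let $P_1$, $P_2$ be non-zero complex polynomials (possibly constant). If $\deg(Q_1)\neq\deg(Q_2)$ and none of the fundamental rays of $Q_1$ coincides with a fundamental ray of $Q_2$, then the entire function $$F_3(z)=P_1(z)\exp(Q_1(z))+P_2(z)\exp(Q_2(z))+P_3(z)$$ has Baker omitted value (at $\infty$).
   Context: Fundamental rays: $\operatorname{Arg}$ denotes the argument of a non-zero complex number, taken modulo $2\pi$. For a polynomial $Q$ of degree $m\ge 1$, let $\beta_m$ be the argument of its leading coefficient, and put $\alpha_0(Q)=-\frac{\beta_m}{m}-\frac{\pi}{2m}$ and $\alpha_j(Q)=\alpha_0(Q)+\frac{\pi j}{m}$ for $j=1,2,\ldots,2m-1$. For $j=0,1,\ldots,2m-1$, the ray $R_{\alpha_j(Q)}=\{z:\operatorname{Arg}(z)=\alpha_j(Q)\}$ is called a fundamental ray of $Q$. Baker omitted value: A point $a\in\widehat{\mathbb C}$ is an omitted value of an entire function $f:\mathbb C\to\mathbb C$ if $f(z)\neq a$ for every $z\in\mathbb C$; the point $\infty$ is always an omitted value of a transcendental entire function. An omitted value $a\in\widehat{\mathbb C}$ of an entire function $f$ is called a Baker omitted value (bov) of $f$ if there is a disk $D$ (in the spherical metric) centered at $a$ such that $f^{-1}(D)\subset\mathbb C$ is infinitely connected (i.e. it is a domain, in particular connected, of infinite connectivity) and each connected component of the boundary of $f^{-1}(D)$ (boundary taken in $\mathbb C$) is bounded. Saying that an entire function "has bov" means that $\infty$ is a Baker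 omitted value of it. *)

theory Defs
  imports
    "HOL-Analysis.Analysis"
    "HOL-Computational_Algebra.Polynomial"
    "HOL-Library.Real_Mod"
begin

(* The point at infinity of the Riemann sphere is None.  The spherical metric is the geodesic
   distance on the unit sphere, of diameter pi; each arcsin argument is half the chordal distance. *)

type_synonym riemann_sphere = "complex option"

abbreviation riemann_sphere_topology :: "riemann_sphere topology" where
  "riemann_sphere_topology \<equiv> Alexandroff_compactification euclidean"

fun spherical_dist :: "riemann_sphere \<Rightarrow> riemann_sphere \<Rightarrow> real" where
  "spherical_dist (Some z) (Some w) =
     2 * arcsin (norm (z - w) / (sqrt (1 + (norm z)\<^sup>2) * sqrt (1 + (norm w)\<^sup>2)))"
| "spherical_dist (Some z) None = 2 * arcsin (1 / sqrt (1 + (norm z)\<^sup>2))"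
| "spherical_dist None (Some z) = 2 * arcsin (1 / sqrt (1 + (norm z)\<^sup>2))"
| "spherical_dist None None = 0"

definition spherical_disk :: "riemann_sphere \<Rightarrow> real \<Rightarrow> riemann_sphere set" where
  "spherical_disk a r = {w. spherical_dist a w < r}"

lemma spherical_disk_infinity:
  assumes "0 < r" "r < pi"
  shows "spherical_disk None r = insert None (Some ` {z. norm z > cot (r / 2)})"
proof -
  have sq: "a < b \<longleftrightarrow> a\<^sup>2 < b\<^sup>2" if "0 \<le> a" "0 \<le> b" for a b :: real
    using that by (metis linorder_not_le power_mono power2_le_imp_le)
  have "spherical_dist None (Some z) < r \<longleftrightarrow> norm z > cot (r / 2)" for z
  proof -
    define s where "s = sqrt (1 + (norm z)\<^sup>2)"
    have s1: "1 \<le> s" by (simp add: s_def)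
    have s0: "0 < s" using s1 by linarith
    have s2: "s\<^sup>2 = 1 + (norm z)\<^sup>2" by (simp add: s_def)
    have sn: "0 < sin (r / 2)" using assms by (intro sin_gt_zero) auto
    have cs: "0 < cos (r / 2)" using assms by (intro cos_gt_zero) auto
    have inv: "1 / s \<le> 1" "-1 \<le> 1 / s" using s1 s0 by (auto simp: divide_simps)
    have "spherical_dist None (Some z) < r \<longleftrightarrow> arcsin (1 / s) < r / 2"
      unfolding s_def spherical_dist.simps by linarith
    also have "\<dots> \<longleftrightarrow> sin (arcsin (1 / s)) < sin (r / 2)"
      using inv assms arcsin_bounded[of "1 / s"]
      by (subst sin_mono_less_eq) auto
    also have "\<dots> \<longleftrightarrow> 1 < sin (r / 2) * s"
      using inv s0 by (simp add: field_simps)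
    also have "\<dots> \<longleftrightarrow> 1\<^sup>2 < (sin (r / 2) * s)\<^sup>2"
      using s0 sn by (intro sq) auto
    also have "\<dots> \<longleftrightarrow> (cos (r / 2))\<^sup>2 < (sin (r / 2) * norm z)\<^sup>2"
      by (simp add: power_mult_distrib s2 cos_squared_eq algebra_simps)
    also have "\<dots> \<longleftrightarrow> cos (r / 2) < sin (r / 2) * norm z"
      using sn cs by (intro sq[symmetric]) auto
    also have "\<dots> \<longleftrightarrow> norm z > cot (r / 2)"
      using sn by (simp add: cot_def field_simps)
    finally show ?thesis .
  qed
  then have "w \<in> spherical_disk None r \<longleftrightarrow> w \<in> insert None (Some ` {z. norm z > cot (r / 2)})" for w
    using assms by (cases w) (auto simp: spherical_disk_def simp del: spherical_dist.simps(2,3))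
  then show ?thesis by blast
qed

definition omitted_value :: "(complex \<Rightarrow> complex) \<Rightarrow> riemann_sphere \<Rightarrow> bool" where
  "omitted_value f a \<longleftrightarrow> (\<forall>z. Some (f z) \<noteq> a)"

(* The connectivity of a plane domain is the number of components of its complement in the sphere. *)
definition infinitely_connected_domain :: "complex set \<Rightarrow> bool" where
  "infinitely_connected_domain U \<longleftrightarrow>
     U \<noteq> {} \<and> open U \<and> connected U \<and>
     infinite (connected_components_of (subtopology riemann_sphere_topology (- (Some ` U))))"

(* r < pi excludes the degenerate disks: for r = pi the disk is the sphere minus the antipode b of a,
   so its preimage would be infinitely connected with singleton boundary components
   as soon as f takes the value b infinitely often. *)
definition baker_omitted_value :: "(complex \<Rightarrow> complex) \<Rightarrow> riemann_sphere \<Rightarrow> bool" where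
  "baker_omitted_value f a \<longleftrightarrow>
     f holomorphic_on UNIV \<and> omitted_value f a \<and>
     (\<exists>r. 0 < r \<and> r < pi \<and>
        (let U = {z. Some (f z) \<in> spherical_disk a r} in
          infinitely_connected_domain U \<and> (\<forall>C \<in> components (frontier U). bounded C)))"

abbreviation has_bov :: "(complex \<Rightarrow> complex) \<Rightarrow> bool" where
  "has_bov f \<equiv> baker_omitted_value f None"

definition ray :: "real \<Rightarrow> complex set" where
  "ray \<alpha> = {z. z \<noteq> 0 \<and> [Arg z = \<alpha>] (rmod 2 * pi)}"

(* Another choice of the argument of the leading coefficient only permutes the fundamental rays. *)
definition fundamental_angle :: "complex poly \<Rightarrow> nat \<Rightarrow> real" where
  "fundamental_angle Q j =
     (- Arg (lead_coeff Q) / real (degree Q) - pi / (2 * real (degree Q))) + pi * real j / real (degree Q)"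

definition fundamental_rays :: "complex poly \<Rightarrow> complex set set" where
  "fundamental_rays Q = (\<lambda>j. ray (fundamental_angle Q j)) ` {..<2 * degree Q}"

end

theory Submission
  imports Defs "HOL-Complex_Analysis.Complex_Analysis" "HOL-Real_Asymp.Real_Asymp"
begin

text \<open>
  Let \<open>F = T1 + T2 + P3\<close> with \<open>T1 = P1 * exp Q1\<close> and
  \<open>T2 = P2 * exp Q2\<close>, where \<open>degree Q1 < degree Q2\<close>, and let \<open>A\<close>
  be the set where \<open>norm F \<le> 1\<close>. Everything follows from two facts: every connected subset
  of \<open>A\<close> is bounded, and \<open>A\<close> is unbounded.

  These facts suffice (\<open>has_bov_if_sublevel_components_bounded\<close>). The complement \<open>U\<close>
  of \<open>A\<close> is the preimage of a spherical disk around infinity, and its frontier lies in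
  \<open>A\<close>. By the maximum principle no component of \<open>A\<close> has a hole, and a closed plane set
  none of whose components separates the plane does not separate it either, so \<open>U\<close> is connected.
  Compact components of \<open>A\<close> have compact neighbourhoods that are clopen in \<open>A\<close>, so
  adjoining the point at infinity does not merge them; an unbounded \<open>A\<close> then has infinitely many of
  them.

  That connected subsets of \<open>A\<close> are bounded is where the hypothesis on the rays enters. The
  fundamental rays of \<open>Q\<close> are the directions in which the real part of its leading term vanishes.
  With no common ray, at each point far from the origin the real part of \<open>Q1\<close> or of
  \<open>Q2\<close> is comparable to the modulus of that polynomial, with one sign or the other. Comparing
  sizes, \<open>F\<close> can be small only where two of the three terms \<open>T1\<close>, \<open>T2\<close>,
  \<open>P3\<close> nearly cancel and the third is at most half as large as one of them
  (\<open>eventually_small_value_cases\<close>). The three possible pairs occur on disjoint closed subsets of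
  the far part of \<open>A\<close>, so a connected part of \<open>A\<close> far from the origin has the same
  cancelling pair throughout. The quotient of the pair has the form \<open>p * exp H / q\<close> and stays
  within 1/2 of \<open>-1\<close>. A continuous logarithm of it is then both bounded and, up to
  \<open>O (ln (norm H))\<close>, equal to \<open>H\<close> plus a constant, because by continuity the
  multiple of \<open>2 * pi * \<i>\<close> cannot jump. So \<open>H\<close> is bounded, and with it the
  connected set (\<open>connected_cancellation_set_bounded\<close>).

  That \<open>A\<close> is unbounded holds because \<open>F\<close> is not a polynomial: otherwise
  \<open>1 / F\<close> would be bounded near infinity, and \<open>F\<close> would have at most a pole there.
\<close>

section \<open>Sublevel sets with bounded components\<close>

text \<open>
  A compact component of a locally compact set has arbitrarily small compact relatively open neighbourhoods
  (Sura-Bura). These split off pieces of \<open>A\<close>, although the components of \<open>A\<close>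
  themselves need not be relatively open.
\<close>

lemma compact_clopen_neighbourhood:
  fixes A :: "'a::euclidean_space set"
  assumes "closed A" and bdd: "\<And>C. connected C \<Longrightarrow> C \<subseteq> A \<Longrightarrow> bounded C" and "p \<in> A"
  obtains K V where "p \<in> K" "compact K" "K \<subseteq> A" "open V" "K = A \<inter> V"
proof -
  define C where "C = connected_component_set A p"
  have C: "C \<in> components A" "p \<in> C"
    using \<open>p \<in> A\<close> by (auto simp: C_def componentsI)
  have "closed C"
    using C(1) \<open>closed A\<close> closed_components by blast
  moreover have "bounded C"
    using bdd C(1) in_components_connected in_components_subset by blast
  ultimately have "compact C"
    by (simp add: compact_eq_bounded_closed)
  then obtain K where "openin (top_of_set A) K" "compact K" "C \<subseteq> K"
    using Sura_Bura_clopen_subset[OF closed_imp_locally_compact[OF \<open>closed A\<close>] C(1), of UNIV]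
    by auto
  with C(2) that show thesis
    by (metis inf_le1 openin_open subsetD)
qed

text \<open>
  Only the part of \<open>A\<close> far from the origin matters. By compactness, finitely many compact clopen
  pieces of the far part cover its intersection with the sphere of radius \<open>\<rho>\<close>. Together with
  the part of \<open>A\<close> inside the ball they form a compact clopen piece \<open>W\<close> of
  \<open>A\<close>, so that a connected subset lies either in \<open>W\<close> or entirely in the far part.
\<close>

lemma connected_subset_bounded_if_bounded_outside_ball:
  fixes A :: "'a::euclidean_space set"
  assumes A: "closed A" and out: "\<And>C. connected C \<Longrightarrow> C \<subseteq> A - ball 0 \<rho> \<Longrightarrow> bounded C"
    and C: "connected C" "C \<subseteq> A"
  shows "bounded C"
proof -
  define A' where "A' = A - ball 0 \<rho>"
  have clA': "closed A'"
    unfolding A'_def using A by (simp add: closed_Diff)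
  define S where "S = A' \<inter> cball 0 \<rho>"
  have "compact S"
    unfolding S_def using clA' by (simp add: closed_Int_compact)
  have "\<exists>K V. p \<in> K \<and> compact K \<and> open V \<and> K = A' \<inter> V" if "p \<in> S" for p
    using compact_clopen_neighbourhood[OF clA', of p] out that
    unfolding A'_def S_def by (metis IntD1)
  then obtain K V where KV: "\<And>p. p \<in> S \<Longrightarrow> p \<in> K p \<and> compact (K p) \<and> open (V p) \<and> K p = A' \<inter> V p"
    by metis
  obtain D where D: "D \<subseteq> S" "finite D" "S \<subseteq> (\<Union>p\<in>D. V p)"
    by (rule compactE_image[OF \<open>compact S\<close>, of S V]) (use KV in blast)+
  define L where "L = (\<Union>p\<in>D. K p)"
  have "compact L"
    unfolding L_def using D KV by (intro compact_UN) auto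
  have L: "A' - L = A' - (\<Union>p\<in>D. V p)"
    unfolding L_def using D(1) KV by blast
  have clR: "closed (A' - L)"
    unfolding L using clA' D KV by (intro closed_Diff open_UN) auto
  have SL: "S \<subseteq> L"
    using D KV unfolding L_def S_def by blast
  define W where "W = L \<union> (A \<inter> cball 0 \<rho>)"
  have W: "compact W"
    unfolding W_def using \<open>compact L\<close> A by (intro compact_Un closed_Int_compact) auto
  have cover: "A \<subseteq> W \<union> (A' - L)"
    unfolding W_def A'_def by auto
  have disj: "W \<inter> (A' - L) = {}"
    using SL unfolding W_def S_def by auto
  have "W \<inter> C = {} \<or> (A' - L) \<inter> C = {}"
    using connected_closedD[OF C(1), of W "A' - L"] W clR disj cover C(2) compact_imp_closed by blast
  then have "C \<subseteq> W \<or> C \<subseteq> A'"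
    using cover C(2) by blast
  then show ?thesis
    using out[OF C(1)] W bounded_subset compact_imp_bounded unfolding A'_def by blast
qed

text \<open>
  A component \<open>C\<close> of the sublevel set has no holes: on a bounded component of \<open>- C\<close>
  the maximum principle bounds \<open>f\<close> by its values on \<open>C\<close>, so the hole lies in the
  sublevel set and hence in \<open>C\<close>. In the plane, a closed set separates only if one of its components
  does.
\<close>

lemma connected_superlevel_set:
  assumes f: "f holomorphic_on UNIV"
    and bdd: "\<And>C. connected C \<Longrightarrow> C \<subseteq> {z. norm (f z) \<le> B} \<Longrightarrow> bounded C"
  shows "connected {z. norm (f z) > B}"
proof -
  define A where "A = {z. norm (f z) \<le> B}"
  have cont: "continuous_on UNIV f"
    using f holomorphic_on_imp_continuous_on by blast
  have clA: "closed A"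
    unfolding A_def by (intro closed_Collect_le continuous_intros cont)
  have "connected (- C)" if C: "C \<in> components A" for C
  proof (rule ccontr)
    assume "\<not> connected (- C)"
    have "C \<subseteq> A" "connected C" "C \<noteq> {}"
      using C in_components_subset in_components_connected in_components_nonempty by blast+
    have "closed C"
      using C clA closed_components by blast
    have "bounded C"
      using bdd \<open>C \<subseteq> A\<close> \<open>connected C\<close> unfolding A_def by blast
    obtain V where V: "V \<in> components (- C)" "bounded V"
      using cobounded_has_bounded_component[of "- C"] \<open>bounded C\<close> \<open>\<not> connected (- C)\<close> by auto
    have "frontier V \<subseteq> C"
      using V(1) \<open>closed C\<close> frontier_of_components_closed_complement by blast
    have "V \<subseteq> A"
    proof
      fix x assume "x \<in> V"
      show "x \<in> A"
        unfolding A_def mem_Collect_eq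
      proof (rule maximum_modulus_frontier[OF _ _ \<open>bounded V\<close> _ \<open>x \<in> V\<close>])
        show "f holomorphic_on interior V" "continuous_on (closure V) f"
          using f cont holomorphic_on_subset continuous_on_subset by blast+
        show "norm (f z) \<le> B" if "z \<in> frontier V" for z
          using that \<open>frontier V \<subseteq> C\<close> \<open>C \<subseteq> A\<close> unfolding A_def by blast
      qed
    qed
    have "V \<noteq> {}" "connected V" "V \<subseteq> - C"
      using V in_components_nonempty in_components_connected in_components_subset by blast+
    have "frontier V \<noteq> {}"
      using \<open>V \<noteq> {}\<close> \<open>V \<subseteq> - C\<close> \<open>C \<noteq> {}\<close> by (auto simp: frontier_eq_empty)
    then have "closure V \<inter> C \<noteq> {}"
      using \<open>frontier V \<subseteq> C\<close> unfolding frontier_def by blast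
    then have "connected (C \<union> closure V)"
      using \<open>connected V\<close> \<open>connected C\<close>
      by (intro connected_Un connected_imp_connected_closure) auto
    then have "C \<union> closure V \<subseteq> C"
      using \<open>C \<noteq> {}\<close> \<open>V \<subseteq> A\<close> \<open>C \<subseteq> A\<close> clA
      by (intro components_maximal[OF C]) (auto simp: closure_minimal)
    then have "V \<subseteq> C"
      using closure_subset by blast
    with \<open>V \<noteq> {}\<close> \<open>V \<subseteq> - C\<close> show False
      by blast
  qed
  then have "connected (- A)"
    using nonseparation_by_component_eq clA by blast
  moreover have "- A = {z. norm (f z) > B}"
    unfolding A_def by auto
  ultimately show ?thesis
    by simp
qed

text \<open>
  Each point of \<open>A\<close> lies in a compact clopen piece of \<open>A\<close>, which remains clopen when
  the point at infinity is adjoined, so the component of a finite point avoids a neighbourhood of infinity.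
  Finitely many such bounded components cannot cover an unbounded set.
\<close>

lemma infinite_components_sphere_complement:
  fixes A :: "complex set"
  assumes A: "closed A" and bdd: "\<And>C. connected C \<Longrightarrow> C \<subseteq> A \<Longrightarrow> bounded C" and unb: "\<not> bounded A"
  shows "infinite (connected_components_of
           (subtopology riemann_sphere_topology (insert None (Some ` A))))"
proof
  define X where "X = subtopology riemann_sphere_topology (insert None (Some ` A))"
  assume "finite (connected_components_of (subtopology riemann_sphere_topology (insert None (Some ` A))))"
  then have fin: "finite (connected_components_of X)"
    by (simp add: X_def)
  have top: "topspace X = insert None (Some ` A)"
    unfolding X_def by auto
  have comp: "\<exists>K. compact K \<and> connected_component_of_set X (Some p) \<subseteq> Some ` K" if "p \<in> A" for p
  proof -
    obtain K V where K: "p \<in> K" "compact K" "K \<subseteq> A" "open V" "K = A \<inter> V"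
      using compact_clopen_neighbourhood[OF A bdd \<open>p \<in> A\<close>] by blast
    have "openin X (topspace X \<inter> Some ` V)"
      unfolding X_def using K(4)
      by (metis X_def open_openin openin_Alexandroff_compactification_image_Some
          openin_subtopology_Int2 top topspace_subtopology)
    moreover have "topspace X \<inter> Some ` V = Some ` K"
      unfolding top using K by auto
    moreover have "closedin X (topspace X \<inter> Some ` K)"
      unfolding closedin_subtopology X_def using K compact_imp_closed
      by (intro exI[of _ "Some ` K"]) auto
    moreover have "topspace X \<inter> Some ` K = Some ` K"
      unfolding top using K by auto
    ultimately have "openin X (Some ` K)" "closedin X (Some ` K)"
      by simp_all
    moreover have "connectedin X (connected_component_of_set X (Some p))"
      by (rule connectedin_connected_component_of)
    moreover have "\<not> disjnt (connected_component_of_set X (Some p)) (Some ` K)"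
      using that K(1) connected_component_of_refl[of X "Some p"] unfolding disjnt_def top
      by blast
    ultimately have "connected_component_of_set X (Some p) \<subseteq> Some ` K"
      using connectedin_clopen_cases by blast
    then show ?thesis using K(2) by blast
  qed
  define \<C> where "\<C> = {T \<in> connected_components_of X. \<exists>K. compact K \<and> T \<subseteq> Some ` K}"
  have "A \<subseteq> (\<Union>T\<in>\<C>. Some -` T)"
  proof
    fix p assume p: "p \<in> A"
    then have "connected_component_of_set X (Some p) \<in> \<C>"
      using comp[OF p] unfolding \<C>_def connected_components_of_def top by auto
    moreover have "Some p \<in> connected_component_of_set X (Some p)"
      using p by (simp add: connected_component_of_refl top)
    ultimately show "p \<in> (\<Union>T\<in>\<C>. Some -` T)" by blast
  qed
  moreover have "bounded (\<Union>T\<in>\<C>. Some -` T)"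
  proof (rule bounded_UN)
    show "finite \<C>" using fin unfolding \<C>_def by simp
    show "\<forall>T\<in>\<C>. bounded (Some -` T)"
    proof
      fix T assume "T \<in> \<C>"
      then obtain K where "compact K" "T \<subseteq> Some ` K"
        unfolding \<C>_def by blast
      then show "bounded (Some -` T)"
        by (intro bounded_subset[OF compact_imp_bounded[of K]]) auto
    qed
  qed
  ultimately show False
    using unb bounded_subset by blast
qed

text \<open>
  The disk of radius \<open>2 * arctan (1 / B)\<close> around infinity is the exterior of the circle of
  radius \<open>B\<close>, so this reduces the whole problem to the geometry of one sublevel set.
\<close>

lemma has_bov_if_sublevel_components_bounded:
  assumes f: "f holomorphic_on UNIV" and "B > 0"
    and bdd: "\<And>C. connected C \<Longrightarrow> C \<subseteq> {z. norm (f z) \<le> B} \<Longrightarrow> bounded C"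
    and unb: "\<not> bounded {z. norm (f z) \<le> B}"
  shows "has_bov f"
proof -
  define r where "r = 2 * arctan (1 / B)"
  define U where "U = {z. norm (f z) > B}"
  have r: "0 < r" "r < pi"
    using \<open>B > 0\<close> arctan_ubound[of "1 / B"] by (auto simp: r_def)
  have "cot (r / 2) = B"
    by (simp add: r_def cot_altdef tan_arctan)
  then have U_eq: "{z. Some (f z) \<in> spherical_disk None r} = U"
    using spherical_disk_infinity[OF r] unfolding U_def by auto
  have cont: "continuous_on UNIV f"
    using f holomorphic_on_imp_continuous_on by blast
  have opn: "open U"
    unfolding U_def by (intro open_Collect_less continuous_intros cont)
  have compl: "- U = {z. norm (f z) \<le> B}"
    unfolding U_def by auto
  have conn: "connected U"
    unfolding U_def by (rule connected_superlevel_set[OF f bdd])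
  have ne: "U \<noteq> {}"
  proof
    assume "U = {}"
    then have "bounded (UNIV :: complex set)"
      using bdd[of UNIV] compl by (simp add: connected_UNIV)
    then show False by simp
  qed
  have "- Some ` U = insert None (Some ` (- U))"
  proof (rule set_eqI)
    show "x \<in> - Some ` U \<longleftrightarrow> x \<in> insert None (Some ` (- U))" for x
      by (cases x) auto
  qed
  moreover have "infinite (connected_components_of
      (subtopology riemann_sphere_topology (insert None (Some ` (- U)))))"
    using opn unb bdd unfolding compl[symmetric]
    by (intro infinite_components_sphere_complement) auto
  ultimately have inf: "infinitely_connected_domain U"
    unfolding infinitely_connected_domain_def using ne opn conn by simp
  have "bounded C" if "C \<in> components (frontier U)" for C
  proof (rule bdd)
    show "connected C" using that in_components_connected by blast
    have "frontier U \<subseteq> - U"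
      using opn by (auto simp: frontier_def interior_open)
    then show "C \<subseteq> {z. norm (f z) \<le> B}"
      using that compl in_components_subset by blast
  qed
  with inf r f show ?thesis
    unfolding baker_omitted_value_def omitted_value_def U_eq[symmetric] Let_def by auto
qed

text \<open>
  If \<open>f\<close> were bounded away from 0 near infinity, the singularity of \<open>1 / f\<close> at
  infinity would be removable, and an entire function with at most a pole at infinity is a polynomial.
\<close>

lemma unbounded_sublevel_set:
  assumes f: "f holomorphic_on UNIV" and nonpoly: "\<nexists>p. \<forall>z. f z = poly p z" and "B > 0"
  shows "\<not> bounded {z. norm (f z) \<le> B}"
proof
  assume "bounded {z. norm (f z) \<le> B}"
  then obtain r where r: "r > 0" "\<And>z. norm (f z) \<le> B \<Longrightarrow> norm z \<le> r"
    unfolding bounded_pos by auto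
  have big: "norm (f (inverse w)) > B" if "w \<noteq> 0" "norm w < inverse r" for w
  proof -
    have "norm (inverse w) > r"
      using that r(1) by (simp add: norm_inverse) (metis inverse_inverse_eq less_imp_inverse_less zero_less_norm_iff)
    then show ?thesis using r(2)[of "inverse w"] by linarith
  qed
  define g where "g = inverse \<circ> f \<circ> inverse"
  have "g holomorphic_on ball 0 (inverse r) - {0}"
    unfolding g_def comp_def using big \<open>B > 0\<close>
    by (intro holomorphic_intros holomorphic_on_compose[OF _ holomorphic_on_subset[OF f], unfolded comp_def]) force+
  moreover have "\<forall>\<^sub>F w in at 0. norm (g w) \<le> inverse B"
    unfolding eventually_at
  proof (intro exI[of _ "inverse r"] conjI ballI impI)
    fix w :: complex assume w: "w \<noteq> 0 \<and> dist w 0 < inverse r"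
    then have "norm (f (inverse w)) > B" by (intro big) auto
    then show "norm (g w) \<le> inverse B"
      using \<open>B > 0\<close> by (simp add: g_def norm_inverse le_imp_inverse_le)
  qed (use r in auto)
  ultimately obtain h where h: "h holomorphic_on ball 0 (inverse r)"
      "\<forall>w\<in>ball 0 (inverse r) - {0}. h w = g w"
    using holomorphic_on_extend_bounded[of g "ball 0 (inverse r)" 0] r(1) by auto
  have "h \<midarrow>0\<rightarrow> h 0"
    using holomorphic_on_imp_continuous_on[OF h(1)] r(1)
    by (simp add: continuous_on_eq_continuous_at isCont_def)
  then have "g \<midarrow>0\<rightarrow> h 0"
    by (rule Lim_transform_within_open[of _ _ _ _ "ball 0 (inverse r)"]) (use h(2) r(1) in auto)
  then have "((inverse \<circ> f) \<longlongrightarrow> h 0) at_infinity"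
    unfolding lim_at_infinity_0 g_def by (simp add: comp_assoc)
  then obtain a n where a: "\<And>z. f z = (\<Sum>i\<le>n. a i * z ^ i)"
    using pole_at_infinity[OF f] by blast
  have "f z = poly (\<Sum>i\<le>n. monom (a i) i) z" for z
    unfolding a by (simp add: poly_sum poly_monom)
  then show False using nonpoly by blast
qed

section \<open>Growth of polynomials\<close>

text \<open>
  In the induction step half of the exponential rate is kept for the coefficient polynomial, and the other half
  absorbs the new factor \<open>z\<close>.
\<close>

lemma poly_norm_le_const_mult_exp:
  fixes p :: "complex poly"
  assumes "\<epsilon> > 0"
  shows "\<exists>K. \<forall>z. norm (poly p z) \<le> K * exp (\<epsilon> * norm z)"
  using assms
proof (induction p arbitrary: \<epsilon>)
  case 0
  then show ?case by (intro exI[of _ 0]) auto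
next
  case (pCons a p)
  from pCons.IH[of "\<epsilon> / 2"] pCons.prems
  obtain K where K: "\<And>z. norm (poly p z) \<le> K * exp (\<epsilon> / 2 * norm z)"
    by auto
  have "norm (poly (pCons a p) z) \<le> (norm a + 2 / \<epsilon> * K) * exp (\<epsilon> * norm z)" for z
  proof -
    define E where "E = exp (\<epsilon> / 2 * norm z)"
    have E: "E * E = exp (\<epsilon> * norm z)" "1 \<le> E" "norm z \<le> 2 / \<epsilon> * E"
      using pCons.prems exp_ge_add_one_self[of "\<epsilon> / 2 * norm z"]
      by (auto simp: E_def field_simps simp flip: exp_add)
    have "1 * 1 \<le> E * E"
      using E(2) by (intro mult_mono) auto
    have "norm (poly (pCons a p) z) \<le> norm a + norm z * norm (poly p z)"
      by (simp add: norm_triangle_le norm_mult)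
    also have "norm z * norm (poly p z) \<le> (2 / \<epsilon> * E) * (K * E)"
      using K[of z] E pCons.prems unfolding E_def[symmetric]
      by (intro mult_mono) auto
    also have "norm a + (2 / \<epsilon> * E) * (K * E) \<le> norm a * (E * E) + 2 / \<epsilon> * K * (E * E)"
      using \<open>1 * 1 \<le> E * E\<close> mult_left_mono[of 1 "E * E" "norm a"] by (simp add: algebra_simps)
    also have "\<dots> = (norm a + 2 / \<epsilon> * K) * exp (\<epsilon> * norm z)"
      by (simp add: E algebra_simps)
    finally show ?thesis by simp
  qed
  then show ?case by blast
qed

lemma eventually_at_infinity_ge:
  "eventually (\<lambda>z :: complex. norm z \<ge> K) at_infinity"
  unfolding eventually_at_infinity by blast

lemma eventually_poly_norm_le_exp:
  fixes p :: "complex poly"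
  assumes "\<epsilon> > 0"
  shows "eventually (\<lambda>z. norm (poly p z) \<le> exp (\<epsilon> * norm z)) at_infinity"
proof -
  obtain K where K: "\<And>z. norm (poly p z) \<le> K * exp (\<epsilon> / 2 * norm z)"
    using poly_norm_le_const_mult_exp[of "\<epsilon> / 2" p] assms by auto
  show ?thesis
    using eventually_at_infinity_ge[of "2 * K / \<epsilon>"]
  proof eventually_elim
    case (elim z)
    have "K \<le> exp (\<epsilon> / 2 * norm z)"
      using elim assms exp_ge_add_one_self[of "\<epsilon> / 2 * norm z"] by (simp add: field_simps)
    then have "K * exp (\<epsilon> / 2 * norm z) \<le> exp (\<epsilon> / 2 * norm z) * exp (\<epsilon> / 2 * norm z)"
      by (intro mult_right_mono) auto
    also have "\<dots> = exp (\<epsilon> * norm z)"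
      by (simp flip: exp_add)
    finally show ?case using K[of z] by linarith
  qed
qed

lemma eventually_poly_norm_ge:
  fixes p :: "complex poly"
  assumes "degree p > 0"
  shows "eventually (\<lambda>z. K \<le> norm (poly p z)) at_infinity"
  using filterlim_poly_at_infinity[OF assms]
  by (rule filterlim_at_infinity_imp_norm_at_top[THEN filterlim_at_top[THEN iffD1], rule_format])

lemma eventually_poly_norm_ge_const:
  fixes p :: "complex poly"
  assumes "p \<noteq> 0"
  shows "\<exists>c>0. eventually (\<lambda>z. c \<le> norm (poly p z)) at_infinity"
proof (cases "degree p = 0")
  case True
  then obtain a where "p = [:a:]" by (rule degree_eq_zeroE)
  then show ?thesis using assms by (intro exI[of _ "norm a"]) auto
next
  case False
  then have "eventually (\<lambda>z. 1 \<le> norm (poly p z)) at_infinity"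
    by (intro eventually_poly_norm_ge) auto
  then show ?thesis by (intro exI[of _ 1]) auto
qed

lemma eventually_poly_norm_ge_linear:
  fixes H :: "complex poly"
  assumes "degree H > 0"
  shows "\<exists>c>0. eventually (\<lambda>z. c * norm z \<le> norm (poly H z)) at_infinity"
proof -
  define a where "a = norm (lead_coeff H)"
  have a: "a > 0" using assms by (auto simp: a_def)
  have "((\<lambda>z. norm (poly H z / z ^ degree H)) \<longlongrightarrow> a) at_infinity"
    unfolding a_def by (intro tendsto_norm poly_divide_tendsto_aux)
  then have "eventually (\<lambda>z. norm (poly H z / z ^ degree H) > a / 2) at_infinity"
    using a by (intro order_tendstoD) auto
  then have "eventually (\<lambda>z. a / 2 * norm z \<le> norm (poly H z)) at_infinity"
    using eventually_at_infinity_ge[of 1]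
  proof eventually_elim
    case (elim z)
    have "norm z ^ 1 \<le> norm z ^ degree H"
      using elim assms by (intro power_increasing) auto
    then have "a / 2 * norm z \<le> a / 2 * norm z ^ degree H"
      using a by (intro mult_left_mono) auto
    also have "\<dots> \<le> norm (poly H z)"
    proof -
      have "0 < norm z ^ degree H" using elim by (intro zero_less_power) linarith
      then show ?thesis
        using elim by (simp add: norm_divide norm_power field_simps)
    qed
    finally show ?case .
  qed
  then show ?thesis using a by (intro exI[of _ "a / 2"]) auto
qed

lemma eventually_poly_near_leading_term:
  fixes Q :: "complex poly"
  assumes "\<delta> > 0"
  shows "\<forall>\<^sub>F z in at_infinity.
    norm (poly Q z - lead_coeff Q * z ^ degree Q) \<le> \<delta> * norm z ^ degree Q"
  using tendstoD[OF poly_divide_tendsto_aux[of Q] assms] eventually_at_infinity_ge[of 1]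
proof eventually_elim
  case (elim z)
  have z: "z \<noteq> 0" using elim by auto
  have "poly Q z - lead_coeff Q * z ^ degree Q = (poly Q z / z ^ degree Q - lead_coeff Q) * z ^ degree Q"
    using z by (simp add: field_simps)
  also have "norm \<dots> \<le> \<delta> * norm z ^ degree Q"
    using elim by (simp add: norm_mult norm_power dist_norm mult_right_mono less_imp_le)
  finally show ?case .
qed

section \<open>Cancellation between two exponential terms\<close>

text \<open>
  Two logarithms of the same number differ by a multiple of \<open>2 * pi * \<i>\<close>, so the range of
  \<open>f\<close> is discrete.
\<close>

lemma constant_on_if_exp_constant:
  fixes f :: "'a::topological_space \<Rightarrow> complex"
  assumes "connected S" "continuous_on S f" "\<And>x. x \<in> S \<Longrightarrow> exp (f x) = c"
  shows "f constant_on S"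
proof (rule continuous_discrete_range_constant[OF assms(1,2)])
  fix x assume x: "x \<in> S"
  have "1 \<le> norm (f y - f x)" if "y \<in> S" "f y \<noteq> f x" for y
  proof -
    have "exp (f y) = exp (f x)"
      using assms(3) x that(1) by simp
    then obtain n :: int where n: "f y = f x + of_real (of_int (2 * n) * pi) * \<i>"
      unfolding exp_eq by blast
    with that have "n \<noteq> 0" by auto
    have "norm (f y - f x) = 2 * \<bar>real_of_int n\<bar> * pi"
      unfolding n by (simp add: norm_mult)
    moreover have "1 \<le> \<bar>real_of_int n\<bar>" using \<open>n \<noteq> 0\<close> by linarith
    moreover have "1 * 1 \<le> \<bar>real_of_int n\<bar> * pi"
      using \<open>1 \<le> \<bar>real_of_int n\<bar>\<close> pi_gt3 by (intro mult_mono) auto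
    ultimately show ?thesis by linarith
  qed
  then show "\<exists>e>0. \<forall>y. y \<in> S \<and> f y \<noteq> f x \<longrightarrow> e \<le> norm (f y - f x)"
    by (intro exI[of _ 1]) auto
qed

lemma norm_Ln_le:
  assumes "w \<noteq> 0"
  shows "norm (Ln w) \<le> \<bar>ln (norm w)\<bar> + pi"
proof -
  have "norm (Ln w) \<le> \<bar>Re (Ln w)\<bar> + \<bar>Im (Ln w)\<bar>"
    by (rule cmod_le)
  moreover have "\<bar>Im (Ln w)\<bar> \<le> pi"
    using Im_Ln_le_pi[OF assms] mpi_less_Im_Ln[OF assms] by linarith
  ultimately show ?thesis using assms by simp
qed

lemma Ln_bound_near_one:
  fixes w :: complex
  assumes "norm (w - 1) \<le> 1 / 2"
  shows "w \<noteq> 0" "w \<notin> \<real>\<^sub>\<le>\<^sub>0" "norm (Ln w) \<le> 5"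
proof -
  have "\<bar>Re (w - 1)\<bar> \<le> 1 / 2"
    using abs_Re_le_cmod[of "w - 1"] assms by linarith
  then have "Re w > 0" unfolding minus_complex.sel one_complex.sel by linarith
  then show 0: "w \<noteq> 0" "w \<notin> \<real>\<^sub>\<le>\<^sub>0"
    by (auto simp: complex_nonpos_Reals_iff)
  have w: "1 / 2 \<le> norm w" "norm w \<le> 3 / 2"
    using assms norm_triangle_ineq2[of 1 w] norm_triangle_ineq2[of w 1]
    by (auto simp: norm_minus_commute)
  have "ln (norm w) \<le> 1"
    using ln_le_minus_one[of "norm w"] w by linarith
  moreover have "- ln (norm w) \<le> 1"
  proof -
    have "0 < norm w" "1 / norm w \<le> 2" using w by (auto simp: divide_le_eq)
    then show ?thesis using ln_le_minus_one[of "1 / norm w"] by (simp add: ln_div)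
  qed
  ultimately show "norm (Ln w) \<le> 5"
    using norm_Ln_le[OF 0(1)] pi_less_4 by linarith
qed

text \<open>
  Both powers have degree \<open>degree p * degree H\<close>. This trades a polynomial factor
  \<open>p\<close> for a power of \<open>H\<close>, up to a factor close to 1 whose principal logarithm is
  harmless.
\<close>

lemma tendsto_poly_power_ratio:
  fixes p H :: "complex poly"
  assumes "p \<noteq> 0" "degree H > 0"
  defines "c \<equiv> lead_coeff p ^ degree H / lead_coeff H ^ degree p"
  shows "c \<noteq> 0"
    "((\<lambda>z. poly p z ^ degree H / (c * poly H z ^ degree p)) \<longlongrightarrow> 1) at_infinity"
proof -
  have "H \<noteq> 0" using assms by auto
  show c: "c \<noteq> 0" using assms \<open>H \<noteq> 0\<close> by auto
  have "((\<lambda>z. (poly p z / z ^ degree p) ^ degree H / (c * (poly H z / z ^ degree H) ^ degree p))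
           \<longlongrightarrow> lead_coeff p ^ degree H / (c * lead_coeff H ^ degree p)) at_infinity"
    using c \<open>H \<noteq> 0\<close> by (intro tendsto_intros poly_divide_tendsto_aux) auto
  also have "lead_coeff p ^ degree H / (c * lead_coeff H ^ degree p) = 1"
    using assms \<open>H \<noteq> 0\<close> by (auto simp: c_def)
  finally show "((\<lambda>z. poly p z ^ degree H / (c * poly H z ^ degree p)) \<longlongrightarrow> 1) at_infinity"
  proof (rule Lim_transform_eventually)
    show "\<forall>\<^sub>F z in at_infinity. (poly p z / z ^ degree p) ^ degree H / (c * (poly H z / z ^ degree H) ^ degree p)
             = poly p z ^ degree H / (c * poly H z ^ degree p)"
      using eventually_at_infinity_ge[of 1]
    proof eventually_elim
      case (elim z)
      then have "z \<noteq> 0" by auto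
      then show ?case
        by (simp add: power_divide flip: power_mult) (simp add: mult.commute)
    qed
  qed
qed

text \<open>
  Where \<open>p * exp H\<close> nearly cancels \<open>q\<close>, the quotient
  \<open>W = - p * exp H / q\<close> stays within 1/2 of 1. Since \<open>p\<close> and \<open>q\<close>
  grow slower than \<open>exp (\<epsilon> * norm H)\<close> for each \<open>\<epsilon> > 0\<close>, the
  real part of \<open>H\<close> is small compared with \<open>norm H\<close>; so \<open>Im H\<close> has no
  zero on \<open>C\<close>, and \<open>H\<close> has a continuous logarithm there. A continuous logarithm of
  \<open>p / q\<close> would need more information about \<open>C\<close>, but the power with exponent
  \<open>d = degree H\<close> of \<open>p / q\<close> is a constant times a power of \<open>H\<close> times
  a factor near 1. Taking logarithms of \<open>W ^ d\<close> in two ways gives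
  \<open>d * H = constant + O (ln (norm H))\<close> on \<open>C\<close>, hence \<open>H\<close> and
  \<open>C\<close> are bounded.
\<close>

lemma connected_cancellation_set_bounded:
  fixes p q H :: "complex poly"
  assumes "p \<noteq> 0" "q \<noteq> 0" "degree H > 0"
  shows "\<exists>\<rho>. \<forall>C. connected C \<longrightarrow>
           (\<forall>z\<in>C. \<rho> \<le> norm z \<and> norm (poly p z * exp (poly H z) + poly q z) \<le> norm (poly q z) / 2) \<longrightarrow>
           bounded C"
proof -
  define d m n where "d = degree H" and "m = degree p" and "n = degree q"
  define c1 where "c1 = lead_coeff p ^ d / lead_coeff H ^ m"
  define c2 where "c2 = lead_coeff q ^ d / lead_coeff H ^ n"
  define u where "u = (\<lambda>z. poly p z ^ d / (c1 * poly H z ^ m))"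
  define v where "v = (\<lambda>z. poly q z ^ d / (c2 * poly H z ^ n))"
  have c12: "c1 \<noteq> 0" "c2 \<noteq> 0"
    using tendsto_poly_power_ratio(1)[of p H] tendsto_poly_power_ratio(1)[of q H] assms
    by (simp_all add: c1_def c2_def d_def m_def n_def)
  have "(u \<longlongrightarrow> 1) at_infinity" "(v \<longlongrightarrow> 1) at_infinity"
    unfolding u_def v_def c1_def c2_def d_def m_def n_def
    using tendsto_poly_power_ratio(2)[OF assms(1,3)] tendsto_poly_power_ratio(2)[OF assms(2,3)]
    by simp_all
  then have uv: "\<forall>\<^sub>F z in at_infinity. norm (u z - 1) \<le> 1 / 2" "\<forall>\<^sub>F z in at_infinity. norm (v z - 1) \<le> 1 / 2"
    by (auto dest!: tendstoD[of _ _ _ "1 / 2"] elim: eventually_mono simp: dist_norm)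
  obtain c where c: "c > 0" "\<forall>\<^sub>F z in at_infinity. c \<le> norm (poly p z)"
    using eventually_poly_norm_ge_const[OF assms(1)] by blast
  obtain c' where c': "c' > 0" "\<forall>\<^sub>F z in at_infinity. c' \<le> norm (poly q z)"
    using eventually_poly_norm_ge_const[OF assms(2)] by blast
  obtain b where b: "b > 0" "\<forall>\<^sub>F z in at_infinity. b * norm z \<le> norm (poly H z)"
    using eventually_poly_norm_ge_linear[OF assms(3)] by blast
  have le_exp: "\<forall>\<^sub>F z in at_infinity. norm (poly p z) \<le> exp (b / 4 * norm z)"
     "\<forall>\<^sub>F z in at_infinity. norm (poly q z) \<le> exp (b / 4 * norm z)"
    using b(1) by (intro eventually_poly_norm_le_exp; simp)+
  \<comment> \<open>With \<open>norm H\<close> this large, \<open>c * exp (norm H / 4)\<close> and \<open>c' * exp (norm H / 4)\<close> exceed 2.\<close>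
  have bigH: "\<forall>\<^sub>F z in at_infinity. max 1 (max (8 / c) (8 / c')) \<le> norm (poly H z)"
    using assms(3) by (intro eventually_poly_norm_ge) auto
  have "\<forall>\<^sub>F z in at_infinity. norm (u z - 1) \<le> 1 / 2 \<and> norm (v z - 1) \<le> 1 / 2 \<and>
      c \<le> norm (poly p z) \<and> c' \<le> norm (poly q z) \<and> b * norm z \<le> norm (poly H z) \<and>
      norm (poly p z) \<le> exp (b / 4 * norm z) \<and> norm (poly q z) \<le> exp (b / 4 * norm z) \<and>
      max 1 (max (8 / c) (8 / c')) \<le> norm (poly H z)"
    by (intro eventually_conj uv c(2) c'(2) b(2) le_exp bigH)
  then obtain \<rho> where \<rho>: "\<And>z. \<rho> \<le> norm z \<Longrightarrow> norm (u z - 1) \<le> 1 / 2 \<and> norm (v z - 1) \<le> 1 / 2 \<and>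
      c \<le> norm (poly p z) \<and> c' \<le> norm (poly q z) \<and> b * norm z \<le> norm (poly H z) \<and>
      norm (poly p z) \<le> exp (b / 4 * norm z) \<and> norm (poly q z) \<le> exp (b / 4 * norm z) \<and>
      max 1 (max (8 / c) (8 / c')) \<le> norm (poly H z)"
    unfolding eventually_at_infinity by blast
  show ?thesis
  proof (intro exI[of _ \<rho>] allI impI)
    fix C assume C: "connected C"
      and "\<forall>z\<in>C. \<rho> \<le> norm z \<and> norm (poly p z * exp (poly H z) + poly q z) \<le> norm (poly q z) / 2"
    then have C1: "\<And>z. z \<in> C \<Longrightarrow> \<rho> \<le> norm z"
      and C2: "\<And>z. z \<in> C \<Longrightarrow> norm (poly p z * exp (poly H z) + poly q z) \<le> norm (poly q z) / 2"
      by auto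
    note far = \<rho>[OF C1]
    have nz: "poly p z \<noteq> 0" "poly q z \<noteq> 0" "poly H z \<noteq> 0" "1 \<le> norm (poly H z)" if "z \<in> C" for z
      using far[OF that] c(1) c'(1) by auto
    define W where "W = (\<lambda>z. - (poly p z * exp (poly H z) / poly q z))"
    have W: "norm (W z - 1) \<le> 1 / 2" if "z \<in> C" for z
    proof -
      have "W z - 1 = - ((poly p z * exp (poly H z) + poly q z) / poly q z)"
        using nz[OF that] by (simp add: W_def field_simps)
      then show ?thesis
        using C2[OF that] nz[OF that] by (simp add: norm_divide divide_le_eq)
    qed
    \<comment> \<open>If \<open>H z\<close> were real, \<open>exp (H z)\<close> or its inverse would exceed the growth of \<open>p\<close> and \<open>q\<close>.\<close>
    have ImH: "Im (poly H z) \<noteq> 0" if z: "z \<in> C" for z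
    proof
      assume "Im (poly H z) = 0"
      then have ReH: "norm (poly H z) = \<bar>Re (poly H z)\<bar>"
        by (simp add: cmod_eq_Re)
      define h where "h = norm (poly H z)"
      have h: "1 \<le> h" "8 / c \<le> h" "8 / c' \<le> h" "b * norm z \<le> h"
        using far[OF z] by (auto simp: h_def)
      define e where "e = exp (h / 4)"
      have e: "1 + h / 4 \<le> e" unfolding e_def by (rule exp_ge_add_one_self)
      have "exp (b / 4 * norm z) \<le> e"
        unfolding e_def using h(4) by simp
      then have pq: "norm (poly p z) \<le> e" "norm (poly q z) \<le> e" "c \<le> norm (poly p z)" "c' \<le> norm (poly q z)"
        using far[OF z] by auto
      have "2 / c \<le> h / 4" "2 / c' \<le> h / 4" using h by auto
      then have "2 / c < e" "2 / c' < e" using e by linarith+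
      then have ce: "2 < c * e" "2 < c' * e" using c(1) c'(1) by (simp_all add: field_simps)
      have normW: "norm (poly p z) * exp (Re (poly H z)) = norm (W z) * norm (poly q z)"
        using nz[OF z] by (simp add: W_def norm_mult norm_divide)
      have Wb: "1 / 2 \<le> norm (W z)" "norm (W z) \<le> 3 / 2"
        using W[OF z] norm_triangle_ineq2[of 1 "W z"] norm_triangle_ineq2[of "W z" 1]
        by (auto simp: norm_minus_commute)
      have e4: "exp h = e * e * e * e"
        by (simp add: e_def flip: exp_add)
      have e0: "e > 1" using e h(1) by linarith
      have ee: "1 \<le> e * e" using e0 mult_mono[of 1 e 1 e] by auto
      show False
      proof (cases "Re (poly H z) \<ge> 0")
        case True
        then have "c * exp h \<le> norm (poly p z) * exp (Re (poly H z))"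
          using pq ReH by (auto simp: h_def)
        also have "\<dots> \<le> 3 / 2 * e"
          unfolding normW using Wb pq by (intro mult_mono) auto
        finally have "c * e * (e * e) * e \<le> 3 / 2 * e"
          by (simp add: e4 mult_ac)
        then have "c * e * (e * e) \<le> 3 / 2" using e0 by simp
        moreover have "2 * 1 \<le> c * e * (e * e)"
          using ce ee by (intro mult_mono) auto
        ultimately show False by linarith
      next
        case False
        then have eq: "Re (poly H z) = - h" using ReH by (simp add: h_def)
        have "1 / 2 * c' \<le> norm (W z) * norm (poly q z)"
          using Wb pq c'(1) by (intro mult_mono) auto
        also have "\<dots> \<le> e * exp (- h)"
          unfolding normW[symmetric] eq using pq by (intro mult_right_mono) auto
        finally have "1 / 2 * c' * exp h \<le> e"
          by (simp add: exp_minus field_simps)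
        then have "c' * e * (e * e) * e \<le> 2 * e"
          by (simp add: e4 mult_ac)
        then have "c' * e * (e * e) \<le> 2" using e0 by simp
        moreover have "c' * e * 1 \<le> c' * e * (e * e)"
          using ce ee by (intro mult_left_mono) auto
        ultimately show False using ce by linarith
      qed
    qed
    obtain \<sigma> :: real where \<sigma>: "\<sigma> = 1 \<or> \<sigma> = -1" "\<And>z. z \<in> C \<Longrightarrow> \<sigma> * Im (poly H z) > 0"
    proof -
      have "connected ((\<lambda>z. Im (poly H z)) ` C)"
        using C by (intro connected_continuous_image continuous_intros)
      then have between: "0 \<in> (\<lambda>z. Im (poly H z)) ` C"
        if "z \<in> C" "w \<in> C" "Im (poly H z) \<le> 0" "0 \<le> Im (poly H w)" for z w
        using that connected_contains_Icc[of "(\<lambda>z. Im (poly H z)) ` C"] by force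
      have "0 \<notin> (\<lambda>z. Im (poly H z)) ` C" using ImH by force
      then consider "\<forall>z\<in>C. Im (poly H z) > 0" | "\<forall>z\<in>C. Im (poly H z) < 0"
        using between by (meson linorder_le_less_linear less_imp_le)
      then show thesis
      proof cases
        case 1 then show thesis using that[of 1] by auto
      next
        case 2 then show thesis using that[of "-1"] by auto
      qed
    qed
    \<comment> \<open>Dividing \<open>H\<close> by \<open>\<tau>\<close> rotates its values into the right half-plane, where \<open>Ln\<close> is continuous.\<close>
    define \<tau> :: complex where "\<tau> = \<i> * of_real \<sigma>"
    define \<omega> where "\<omega> = (\<lambda>z. poly H z / \<tau>)"
    have \<tau>: "\<tau> \<noteq> 0" "norm \<tau> = 1" using \<sigma>(1) by (auto simp: \<tau>_def)
    have \<omega>: "Re (\<omega> z) > 0" if "z \<in> C" for z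
      using \<sigma>(1) \<sigma>(2)[OF that] by (auto simp: \<omega>_def \<tau>_def Re_divide)
    \<comment> \<open>\<open>\<Phi>\<close> is the difference of the two logarithms of \<open>W ^ d\<close>, up to an additive constant.\<close>
    define \<Phi> where "\<Phi> = (\<lambda>z. Ln (u z) - Ln (v z) + of_nat m * Ln (\<omega> z) - of_nat n * Ln (\<omega> z)
        + of_nat d * poly H z - of_nat d * Ln (W z))"
    have \<omega>0: "\<omega> z \<noteq> 0" "\<omega> z \<notin> \<real>\<^sub>\<le>\<^sub>0" if "z \<in> C" for z
      using \<omega>[OF that] by (auto simp: complex_nonpos_Reals_iff)
    have u0: "u z \<noteq> 0" "u z \<notin> \<real>\<^sub>\<le>\<^sub>0" "norm (Ln (u z)) \<le> 5" if "z \<in> C" for z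
      using Ln_bound_near_one far[OF that] by blast+
    have v0: "v z \<noteq> 0" "v z \<notin> \<real>\<^sub>\<le>\<^sub>0" "norm (Ln (v z)) \<le> 5" if "z \<in> C" for z
      using Ln_bound_near_one far[OF that] by blast+
    have W0: "W z \<noteq> 0" "W z \<notin> \<real>\<^sub>\<le>\<^sub>0" "norm (Ln (W z)) \<le> 5" if "z \<in> C" for z
      using Ln_bound_near_one W[OF that] by blast+
    have "continuous_on C u" "continuous_on C v" "continuous_on C \<omega>" "continuous_on C W"
      unfolding u_def v_def \<omega>_def W_def using c12 nz \<tau>
      by (auto intro!: continuous_intros)
    then have cont: "continuous_on C \<Phi>"
      unfolding \<Phi>_def using u0 v0 W0 \<omega>0
      by (intro continuous_intros) auto
    have "exp (\<Phi> z) = (c2 / c1) * \<tau> ^ n / \<tau> ^ m * (-1) ^ d" if z: "z \<in> C" for z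
    proof -
      have "exp (\<Phi> z) = u z / v z * \<omega> z ^ m / \<omega> z ^ n * exp (poly H z) ^ d / W z ^ d"
        unfolding \<Phi>_def using u0[OF z] v0[OF z] W0[OF z] \<omega>0[OF z]
        by (simp add: exp_add exp_diff exp_of_nat_mult)
      also have "W z ^ d = (-1) ^ d * (poly p z ^ d * exp (poly H z) ^ d / poly q z ^ d)"
        unfolding W_def by (subst power_minus) (simp add: power_divide power_mult_distrib)
      finally have "exp (\<Phi> z) = (poly p z ^ d / (c1 * poly H z ^ m)) / (poly q z ^ d / (c2 * poly H z ^ n))
          * (poly H z ^ m / \<tau> ^ m) / (poly H z ^ n / \<tau> ^ n) * exp (poly H z) ^ d
          / ((-1) ^ d * (poly p z ^ d * exp (poly H z) ^ d / poly q z ^ d))"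
        unfolding u_def v_def \<omega>_def by (simp add: power_divide)
      also have "\<dots> = (c2 / c1) * \<tau> ^ n / \<tau> ^ m * (-1) ^ d"
        if "s * s = 1" "s = (-1) ^ d" for s :: complex
      proof -
        have "s \<noteq> 0" using that by auto
        have *: "(a / (c1 * hm)) / (b / (c2 * hn)) * (hm / tm) / (hn / tn) * e / (s * (a * e / b))
             = (c2 / c1) * tn / tm * s"
          if "a \<noteq> 0" "b \<noteq> 0" "hm \<noteq> 0" "hn \<noteq> 0" "e \<noteq> 0" "tm \<noteq> 0" "tn \<noteq> 0"
          for a b hm hn e tm tn :: complex
        proof -
          have "(a / (c1 * hm)) / (b / (c2 * hn)) * (hm / tm) / (hn / tn) * e / (s * (a * e / b))
              = (c2 / c1) * tn / tm * (1 / s)"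
            using that c12 \<open>s \<noteq> 0\<close> by (simp add: divide_simps)
          also have "1 / s = s" using \<open>s * s = 1\<close> \<open>s \<noteq> 0\<close> by (simp add: field_simps)
          finally show ?thesis .
        qed
        show ?thesis
          unfolding that(2)[symmetric] using nz[OF z] \<tau> by (intro *) auto
      qed
      finally show ?thesis
        by (simp flip: power_mult_distrib)
    qed
    then have "\<Phi> constant_on C"
      by (rule constant_on_if_exp_constant[OF C cont])
    then obtain K where K: "\<And>z. z \<in> C \<Longrightarrow> \<Phi> z = K"
      unfolding constant_on_def by blast
    define M where "M = real (m + n)"
    define L where "L = norm K + 10 + M * pi + real d * 5"
    have ev: "\<forall>\<^sub>F x in at_top. M * ln x + L < x"
      by real_asymp
    then obtain X where X: "\<And>x. x \<ge> X \<Longrightarrow> M * ln x + L < x"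
      unfolding eventually_at_top_linorder by blast
    have "norm z \<le> X / b" if z: "z \<in> C" for z
    proof -
      define h where "h = norm (poly H z)"
      have "h \<ge> 1" using nz[OF z] by (simp add: h_def)
      have "norm (\<omega> z) = h" using \<tau> by (simp add: \<omega>_def h_def norm_divide)
      then have Ln\<omega>: "norm (Ln (\<omega> z)) \<le> ln h + pi"
        using norm_Ln_le[OF \<omega>0(1)[OF z]] \<open>h \<ge> 1\<close> by simp
      have "of_nat d * poly H z =
          K - Ln (u z) + Ln (v z) - of_nat m * Ln (\<omega> z) + of_nat n * Ln (\<omega> z) + of_nat d * Ln (W z)"
        using K[OF z] unfolding \<Phi>_def by (simp add: algebra_simps)
      moreover have "norm (k1 - k2 + k3 - k4 + k5 + k6)
          \<le> norm k1 + norm k2 + norm k3 + norm k4 + norm k5 + norm k6" for k1 k2 k3 k4 k5 k6 :: complex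
        by norm
      ultimately have "norm (of_nat d * poly H z) \<le> norm K + norm (Ln (u z)) + norm (Ln (v z))
          + norm (of_nat m * Ln (\<omega> z)) + norm (of_nat n * Ln (\<omega> z)) + norm (of_nat d * Ln (W z))"
        by simp
      also have "\<dots> = norm K + norm (Ln (u z)) + norm (Ln (v z))
          + M * norm (Ln (\<omega> z)) + real d * norm (Ln (W z))"
        by (simp add: norm_mult M_def algebra_simps)
      also have "\<dots> \<le> norm K + 5 + 5 + M * (ln h + pi) + real d * 5"
        using u0[OF z] v0[OF z] W0[OF z] Ln\<omega>
        by (intro add_mono mult_left_mono) (auto simp: M_def)
      also have "\<dots> = M * ln h + L"
        by (simp add: L_def algebra_simps)
      finally have "real d * h \<le> M * ln h + L"
        by (simp add: norm_mult h_def)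
      moreover have "1 * h \<le> real d * h"
        using assms(3) \<open>h \<ge> 1\<close> by (intro mult_right_mono) (auto simp: d_def)
      ultimately have "h < X" using X[of h] by linarith
      then have "b * norm z \<le> X" using far[OF z] by (auto simp: h_def)
      then show ?thesis using b(1) by (simp add: field_simps)
    qed
    then show "bounded C"
      unfolding bounded_iff by blast
  qed
qed

section \<open>Fundamental rays\<close>

lemma ray_eq_if_common_point:
  assumes "u \<in> ray \<alpha>" "u \<in> ray \<beta>"
  shows "ray \<alpha> = ray \<beta>"
proof -
  have "[\<alpha> = \<beta>] (rmod 2 * pi)"
    using assms unfolding ray_def by (auto intro: rcong_trans rcong_sym)
  then show ?thesis
    unfolding ray_def by (metis rcong_sym rcong_trans)
qed

text \<open>
  The fundamental rays of \<open>Q\<close> are the directions in which the real part of the leading term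
  vanishes.
\<close>

lemma zero_direction_in_fundamental_ray:
  assumes "degree Q > 0" "u \<noteq> 0" and zero: "Re (lead_coeff Q * u ^ degree Q) = 0"
  shows "\<exists>j<2 * degree Q. u \<in> ray (fundamental_angle Q j)"
proof -
  define d a where "d = degree Q" and "a = lead_coeff Q"
  have d: "d > 0" and a: "a \<noteq> 0" using assms(1) by (auto simp: d_def a_def)
  have "a * u ^ d = rcis (norm a) (Arg a) * rcis (norm u) (Arg u) ^ d"
    by (simp add: rcis_cmod_Arg)
  also have "\<dots> = rcis (norm a * norm u ^ d) (Arg a + real d * Arg u)"
    by (simp add: DeMoivre2 rcis_mult)
  finally have "norm a * norm u ^ d * cos (Arg a + real d * Arg u) = 0"
    using zero by (simp add: d_def a_def)
  then have "cos (Arg a + real d * Arg u) = 0"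
    using a assms(2) by simp
  then obtain n :: int where n: "Arg a + real d * Arg u = of_int n * pi + pi / 2"
    unfolding cos_zero_iff_int2 by blast
  \<comment> \<open>The angles of \<open>Q\<close> are counted from \<open>- pi / 2\<close>, which shifts the index by one.\<close>
  define j where "j = nat ((n + 1) mod (2 * int d))"
  define q where "q = (n + 1) div (2 * int d)"
  have j: "j < 2 * d"
    using d by (simp add: j_def nat_less_iff)
  have "n + 1 = int j + 2 * int d * q"
    using d by (simp add: j_def q_def)
  then have "real_of_int (n + 1) = real_of_int (int j + 2 * int d * q)"
    by (rule arg_cong)
  then have n': "real_of_int n = real j + 2 * real d * of_int q - 1"
    by simp
  have "fundamental_angle Q j = Arg u + of_int (- q) * (2 * pi)"
    using n d unfolding fundamental_angle_def n' a_def[symmetric] unfolding d_def[symmetric]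
    by (simp add: field_simps)
  then have "[Arg u = fundamental_angle Q j] (rmod 2 * pi)"
    unfolding rcong_altdef by blast
  with j assms(2) show ?thesis
    unfolding ray_def d_def by blast
qed

text \<open>
  The real parts of the two leading terms have no common zero on the unit circle, so the larger of the two has a
  positive minimum there, and homogeneity extends the bound to the plane.
\<close>

lemma one_exponent_has_large_real_part:
  assumes d: "degree Q1 > 0" "degree Q2 > 0"
    and rays: "fundamental_rays Q1 \<inter> fundamental_rays Q2 = {}"
  shows "\<exists>\<delta>>0. \<forall>\<^sub>F z in at_infinity. \<delta> * norm z ^ degree Q1 \<le> \<bar>Re (poly Q1 z)\<bar> \<or>
             \<delta> * norm z ^ degree Q2 \<le> \<bar>Re (poly Q2 z)\<bar>"
proof -
  define l where "l = (\<lambda>Q z. Re (lead_coeff Q * z ^ degree Q))"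
  define g where "g = (\<lambda>u. max \<bar>l Q1 u\<bar> \<bar>l Q2 u\<bar>)"
  have pos: "g u > 0" if "u \<noteq> 0" for u
  proof (rule ccontr)
    assume "\<not> g u > 0"
    then have "l Q1 u = 0" "l Q2 u = 0" unfolding g_def by auto
    then obtain i j where "i < 2 * degree Q1" "u \<in> ray (fundamental_angle Q1 i)"
        "j < 2 * degree Q2" "u \<in> ray (fundamental_angle Q2 j)"
      using zero_direction_in_fundamental_ray[OF d(1) \<open>u \<noteq> 0\<close>]
        zero_direction_in_fundamental_ray[OF d(2) \<open>u \<noteq> 0\<close>] unfolding l_def by blast
    then have "ray (fundamental_angle Q1 i) \<in> fundamental_rays Q1 \<inter> fundamental_rays Q2"
      using ray_eq_if_common_point unfolding fundamental_rays_def by blast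
    then show False using rays by blast
  qed
  have "continuous_on (sphere 0 1) g"
    unfolding g_def l_def by (intro continuous_intros)
  then obtain u0 where u0: "u0 \<in> sphere (0 :: complex) 1" "\<And>u. u \<in> sphere 0 1 \<Longrightarrow> g u0 \<le> g u"
    using continuous_attains_inf[of "sphere (0 :: complex) 1" g] by auto
  define \<delta> where "\<delta> = g u0 / 2"
  have \<delta>: "\<delta> > 0"
    using pos[of u0] u0(1) by (force simp: \<delta>_def)
  have "\<forall>\<^sub>F z in at_infinity. \<delta> * norm z ^ degree Q1 \<le> \<bar>Re (poly Q1 z)\<bar> \<or>
             \<delta> * norm z ^ degree Q2 \<le> \<bar>Re (poly Q2 z)\<bar>"
    using eventually_poly_near_leading_term[OF \<delta>, of Q1]
      eventually_poly_near_leading_term[OF \<delta>, of Q2] eventually_at_infinity_ge[of 1]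
  proof eventually_elim
    case (elim z)
    define u where "u = z / of_real (norm z)"
    have z: "z = of_real (norm z) * u" "norm z > 0" "norm u = 1"
      using elim(3) by (auto simp: u_def norm_divide)
    have re: "Re (of_real r * w) = r * Re w" for r w
      by simp
    have scale: "\<bar>l Q z\<bar> = norm z ^ degree Q * \<bar>l Q u\<bar>" for Q
    proof -
      have "lead_coeff Q * z ^ degree Q = of_real (norm z ^ degree Q) * (lead_coeff Q * u ^ degree Q)"
        by (subst z(1)) (simp add: power_mult_distrib)
      then have "l Q z = norm z ^ degree Q * l Q u"
        unfolding l_def by (simp only: re)
      then show ?thesis
        by (simp add: abs_mult)
    qed
    have *: "\<delta> * norm z ^ degree Q \<le> \<bar>Re (poly Q z)\<bar>"
      if "norm (poly Q z - lead_coeff Q * z ^ degree Q) \<le> \<delta> * norm z ^ degree Q"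
        and "2 * \<delta> \<le> \<bar>l Q u\<bar>" for Q
    proof -
      have "\<bar>Re (poly Q z) - l Q z\<bar> \<le> \<delta> * norm z ^ degree Q"
        using abs_Re_le_cmod[of "poly Q z - lead_coeff Q * z ^ degree Q"] that(1) by (simp add: l_def)
      moreover have "norm z ^ degree Q * (2 * \<delta>) \<le> \<bar>l Q z\<bar>"
        unfolding scale using that(2) by (intro mult_left_mono) auto
      ultimately show ?thesis by (simp add: mult_ac)
    qed
    have "2 * \<delta> \<le> g u" using u0(2)[of u] z(3) by (simp add: \<delta>_def)
    then have "2 * \<delta> \<le> \<bar>l Q1 u\<bar> \<or> 2 * \<delta> \<le> \<bar>l Q2 u\<bar>" unfolding g_def by linarith
    then show ?case using * elim by blast
  qed
  with \<delta> show ?thesis by blast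
qed

section \<open>Small values of the exponential sum\<close>

text \<open>
  The modulus of \<open>Q1\<close> is of smaller order than \<open>norm z ^ degree Q2\<close>, so neither
  \<open>exp Q1\<close> nor a polynomial can compete with \<open>exp Q2\<close> where \<open>Re Q2\<close>
  has that order.
\<close>

lemma eventually_dominant_exponential:
  fixes P1 P2 P3 Q1 Q2 :: "complex poly"
  assumes "degree Q1 > 0" "degree Q1 < degree Q2" "P2 \<noteq> 0" "\<delta> > 0"
  shows "\<forall>\<^sub>F z in at_infinity. \<delta> * norm z ^ degree Q2 \<le> Re (poly Q2 z) \<longrightarrow>
     norm (poly P1 z * exp (poly Q1 z)) + norm (poly P3 z) + 1 < norm (poly P2 z * exp (poly Q2 z))"
proof -
  obtain c where c: "c > 0" "\<forall>\<^sub>F z in at_infinity. c \<le> norm (poly P2 z)"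
    using eventually_poly_norm_ge_const[OF assms(3)] by blast
  define M where "M = 1 + norm (lead_coeff Q1)"
  define K where "K = 4 / c"
  have M: "M \<ge> 1" and K: "K > 0" using c(1) by (auto simp: M_def K_def)
  show ?thesis
    using c(2) eventually_poly_norm_le_exp[OF zero_less_one, of P1]
      eventually_poly_norm_le_exp[OF zero_less_one, of P3]
      eventually_poly_near_leading_term[OF zero_less_one, of Q1]
      eventually_at_infinity_ge[of "max 1 ((1 + M + K) / \<delta>)"]
  proof eventually_elim
    case (elim z)
    define x y where "x = norm z" and "y = norm z ^ degree Q1"
    have x: "x \<ge> 1" "1 + M + K \<le> \<delta> * x"
      using elim(5) \<open>\<delta> > 0\<close> by (auto simp: x_def field_simps)
    have y: "x \<le> y"
      using power_increasing[of 1 "degree Q1" "norm z"] x(1) assms(1) by (simp add: x_def y_def)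
    have xy: "x * y \<le> norm z ^ degree Q2"
      using power_increasing[of "Suc (degree Q1)" "degree Q2" "norm z"] x(1) assms(2)
      by (simp add: x_def y_def)
    define E where "E = exp ((1 + M) * y)"
    have "norm (poly Q1 z) \<le> norm (lead_coeff Q1 * z ^ degree Q1) + 1 * norm z ^ degree Q1"
      using elim(4) norm_triangle_ineq2[of "poly Q1 z" "lead_coeff Q1 * z ^ degree Q1"] by linarith
    then have Q1: "Re (poly Q1 z) \<le> M * y"
      using complex_Re_le_cmod[of "poly Q1 z"]
      by (simp add: M_def y_def norm_mult norm_power algebra_simps)
    have "norm (poly P1 z * exp (poly Q1 z)) \<le> exp (1 * x) * exp (M * y)"
      unfolding norm_mult norm_exp_eq_Re using elim(2) Q1 by (intro mult_mono) (auto simp: x_def)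
    also have "\<dots> \<le> E"
      unfolding E_def exp_add[symmetric] using y by (simp add: algebra_simps)
    finally have T1: "norm (poly P1 z * exp (poly Q1 z)) \<le> E" .
    have My: "0 \<le> M * y" using M x(1) y by simp
    have "x \<le> (1 + M) * y" using y My by (simp add: algebra_simps)
    then have T3: "norm (poly P3 z) \<le> E"
      using elim(3) unfolding E_def x_def by (smt (verit) exp_le_cancel_iff mult_1)
    have E1: "1 \<le> E" unfolding E_def using My x(1) y by (simp add: algebra_simps)
    show ?case
    proof
      assume *: "\<delta> * norm z ^ degree Q2 \<le> Re (poly Q2 z)"
      have "(1 + M) * y + K \<le> (1 + M + K) * y"
        using K x(1) y mult_left_mono[of 1 y K] by (simp add: algebra_simps)
      also have "\<dots> \<le> \<delta> * x * y"
        using x y by (intro mult_right_mono) auto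
      also have "\<dots> \<le> \<delta> * norm z ^ degree Q2"
        using xy \<open>\<delta> > 0\<close> by (simp add: mult.assoc)
      finally have "exp ((1 + M) * y + K) \<le> exp (Re (poly Q2 z))"
        using * by simp
      then have "c * (E * exp K) \<le> norm (poly P2 z * exp (poly Q2 z))"
        unfolding norm_mult norm_exp_eq_Re E_def exp_add[symmetric] using elim(1) c(1)
        by (intro mult_mono) auto
      moreover have "4 * E < c * (E * exp K)"
      proof -
        have "4 / c < exp K"
          using exp_ge_add_one_self[of K] unfolding K_def by linarith
        then have "4 < c * exp K" using c(1) by (simp add: field_simps)
        then have "E * 4 < E * (c * exp K)" using E1 by (intro mult_strict_left_mono) auto
        then show ?thesis by (simp add: mult_ac)
      qed
      ultimately show "norm (poly P1 z * exp (poly Q1 z)) + norm (poly P3 z) + 1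
          < norm (poly P2 z * exp (poly Q2 z))"
        using T1 T3 E1 by linarith
    qed
  qed
qed

text \<open>
  Far from the origin a small value of the sum requires one of three configurations: \<open>T2\<close> is
  negligible, \<open>T1\<close> is at least twice as large as \<open>P3\<close>, or \<open>T1\<close> is
  negligible. In each of them two terms of the sum nearly cancel.
\<close>

lemma eventually_small_value_cases:
  fixes P1 P2 P3 Q1 Q2 :: "complex poly"
  assumes deg: "degree Q1 > 0" "degree Q1 < degree Q2"
    and P: "P1 \<noteq> 0" "P2 \<noteq> 0"
    and rays: "fundamental_rays Q1 \<inter> fundamental_rays Q2 = {}"
  defines "T1 \<equiv> (\<lambda>z. poly P1 z * exp (poly Q1 z))" and "T2 \<equiv> (\<lambda>z. poly P2 z * exp (poly Q2 z))"
  shows "\<forall>\<^sub>F z in at_infinity. norm (T1 z + T2 z + poly P3 z) \<le> 1 \<longrightarrow>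
    norm (T2 z) \<le> 1 \<or> 2 * (norm (poly P3 z) + 1) \<le> norm (T1 z) \<or> norm (T1 z) \<le> 1"
proof -
  obtain \<delta> where \<delta>: "\<delta> > 0" "\<forall>\<^sub>F z in at_infinity.
      \<delta> * norm z ^ degree Q1 \<le> \<bar>Re (poly Q1 z)\<bar> \<or> \<delta> * norm z ^ degree Q2 \<le> \<bar>Re (poly Q2 z)\<bar>"
    using one_exponent_has_large_real_part[of Q1 Q2] deg rays by auto
  obtain c where c: "c > 0" "\<forall>\<^sub>F z in at_infinity. c \<le> norm (poly P1 z)"
    using eventually_poly_norm_ge_const[OF P(1)] by blast
  have "\<delta> / 2 > 0" using \<delta>(1) by simp
  show ?thesis
    using \<delta>(2) c(2) eventually_dominant_exponential[OF deg P(2) \<delta>(1), of P1 P3]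
      eventually_poly_norm_le_exp[OF \<open>\<delta> / 2 > 0\<close>, of P1]
      eventually_poly_norm_le_exp[OF \<open>\<delta> / 2 > 0\<close>, of P2]
      eventually_poly_norm_le_exp[OF \<open>\<delta> / 2 > 0\<close>, of P3]
      eventually_at_infinity_ge[of "max 1 (8 / (c * \<delta>))"]
  proof eventually_elim
    case (elim z)
    define x where "x = norm z"
    define E where "E = exp (\<delta> / 2 * x)"
    have x: "x \<ge> 1" "8 / (c * \<delta>) \<le> x" using elim(7) by (auto simp: x_def)
    have pow: "\<delta> * x \<le> \<delta> * x ^ degree Q" if "degree Q > 0" for Q :: "complex poly"
      using power_increasing[of 1 "degree Q" x] x(1) that \<delta>(1) by (intro mult_left_mono) auto
    have E: "1 \<le> E" "exp (\<delta> * x) = E * E"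
      using \<delta>(1) x(1) by (auto simp: E_def simp flip: exp_add)
    have small: "norm (poly p z * exp (poly Q z)) \<le> 1"
      if p: "norm (poly p z) \<le> E" and Q: "degree Q > 0" "Re (poly Q z) \<le> - (\<delta> * x ^ degree Q)" for p Q
    proof -
      have "exp (Re (poly Q z)) \<le> exp (- (\<delta> / 2 * x))"
      proof -
        have "0 \<le> \<delta> * x" using \<delta>(1) x(1) by simp
        then have "Re (poly Q z) \<le> - (\<delta> / 2 * x)" using pow[OF Q(1)] Q(2) by simp
        then show ?thesis by simp
      qed
      then have "norm (poly p z) * exp (Re (poly Q z)) \<le> E * exp (- (\<delta> / 2 * x))"
        using p E(1) by (intro mult_mono) auto
      also have "\<dots> = 1" by (simp add: E_def flip: exp_add)
      finally show ?thesis by (simp add: norm_mult)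
    qed
    have P: "norm (poly P1 z) \<le> E" "norm (poly P2 z) \<le> E" "norm (poly P3 z) \<le> E"
      using elim by (auto simp: E_def x_def)
    show ?case
    proof
      assume F: "norm (T1 z + T2 z + poly P3 z) \<le> 1"
      have "norm t2 \<le> norm (t1 + t2 + t3) + norm t1 + norm t3" for t1 t2 t3 :: complex
        by norm
      note this[of "T2 z" "T1 z" "poly P3 z"]
      then have "\<not> \<delta> * x ^ degree Q2 \<le> Re (poly Q2 z)"
        using F elim(3) unfolding T1_def T2_def x_def by linarith
      then consider "Re (poly Q2 z) \<le> - (\<delta> * x ^ degree Q2)" | "Re (poly Q1 z) \<le> - (\<delta> * x ^ degree Q1)"
        | "\<delta> * x ^ degree Q1 \<le> Re (poly Q1 z)"
        using elim(1) unfolding x_def by linarith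
      then show "norm (T2 z) \<le> 1 \<or> 2 * (norm (poly P3 z) + 1) \<le> norm (T1 z) \<or> norm (T1 z) \<le> 1"
      proof cases
        case 1
        then show ?thesis using small[of P2 Q2] P deg unfolding T2_def by auto
      next
        case 2
        then show ?thesis using small[of P1 Q1] P deg unfolding T1_def by auto
      next
        case 3
        then have "exp (\<delta> * x) \<le> exp (Re (poly Q1 z))"
          using pow[OF deg(1)] by simp
        then have "c * (E * E) \<le> norm (T1 z)"
          unfolding T1_def norm_mult norm_exp_eq_Re E(2)[symmetric]
          using elim(2) c(1) by (intro mult_mono) auto
        moreover have "4 * E \<le> c * E * E"
        proof -
          have "4 / c \<le> \<delta> / 2 * x" using x(2) c(1) \<delta>(1) by (simp add: field_simps)
          also have "\<dots> \<le> E" unfolding E_def using exp_ge_add_one_self[of "\<delta> / 2 * x"] by linarith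
          finally have "4 \<le> c * E" using c(1) by (simp add: field_simps)
          then show ?thesis using E(1) by (intro mult_right_mono) auto
        qed
        ultimately have "2 * (norm (poly P3 z) + 1) \<le> norm (T1 z)"
          using P(3) E(1) unfolding mult.assoc distrib_left by linarith
        then show ?thesis by blast
      qed
    qed
  qed
qed

text \<open>
  Far from the origin the three configurations are closed and exclude each other where the sum is small, so a
  connected set of small values stays in one of them. There two of the three terms nearly cancel throughout, and
  their quotient is a rational function times the exponential of \<open>Q1\<close>, of \<open>Q2 - Q1\<close>
  or of \<open>Q2\<close>; all three polynomials are non-constant.
\<close>

lemma connected_subset_of_small_values_bounded:
  fixes P1 P2 P3 Q1 Q2 :: "complex poly"
  assumes deg: "degree Q1 > 0" "degree Q1 < degree Q2" "degree P3 > 0"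
    and P: "P1 \<noteq> 0" "P2 \<noteq> 0"
    and rays: "fundamental_rays Q1 \<inter> fundamental_rays Q2 = {}"
    and C: "connected C"
      "C \<subseteq> {z. norm (poly P1 z * exp (poly Q1 z) + poly P2 z * exp (poly Q2 z) + poly P3 z) \<le> 1}"
  shows "bounded C"
proof -
  define T1 where "T1 = (\<lambda>z. poly P1 z * exp (poly Q1 z))"
  define T2 where "T2 = (\<lambda>z. poly P2 z * exp (poly Q2 z))"
  define A where "A = {z. norm (T1 z + T2 z + poly P3 z) \<le> 1}"
  have contT: "continuous_on UNIV T1" "continuous_on UNIV T2"
    unfolding T1_def T2_def by (auto intro!: continuous_intros)
  have "P3 \<noteq> 0" using deg(3) by auto
  have "degree (Q2 - Q1) = degree Q2"
    using degree_add_eq_left[of "- Q1" Q2] deg(2) by simp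
  then have deg': "degree (Q2 - Q1) > 0" "degree Q2 > 0" using deg by auto
  obtain \<rho>1 where \<rho>1: "\<And>C. connected C \<Longrightarrow> (\<And>z. z \<in> C \<Longrightarrow> \<rho>1 \<le> norm z \<and>
      norm (T1 z + poly P3 z) \<le> norm (poly P3 z) / 2) \<Longrightarrow> bounded C"
    using connected_cancellation_set_bounded[OF P(1) \<open>P3 \<noteq> 0\<close> deg(1)] unfolding T1_def by metis
  obtain \<rho>2 where \<rho>2: "\<And>C. connected C \<Longrightarrow> (\<And>z. z \<in> C \<Longrightarrow> \<rho>2 \<le> norm z \<and>
      norm (T2 z + poly P3 z) \<le> norm (poly P3 z) / 2) \<Longrightarrow> bounded C"
    using connected_cancellation_set_bounded[OF P(2) \<open>P3 \<noteq> 0\<close> deg'(2)] unfolding T2_def by metis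
  obtain \<rho>3 where \<rho>3: "\<And>C. connected C \<Longrightarrow> (\<And>z. z \<in> C \<Longrightarrow> \<rho>3 \<le> norm z \<and>
      norm (poly P2 z * exp (poly (Q2 - Q1) z) + poly P1 z) \<le> norm (poly P1 z) / 2) \<Longrightarrow> bounded C"
    using connected_cancellation_set_bounded[OF P(2) P(1) deg'(1)] by metis
  have quotient: "norm (poly P2 z * exp (poly (Q2 - Q1) z) + poly P1 z) \<le> norm (poly P1 z) / 2"
    if "norm (T1 z + T2 z) \<le> norm (T1 z) / 2" for z
  proof -
    have "T1 z + T2 z = (poly P2 z * exp (poly (Q2 - Q1) z) + poly P1 z) * exp (poly Q1 z)"
      by (simp add: T1_def T2_def exp_diff field_simps)
    then have "norm (poly P2 z * exp (poly (Q2 - Q1) z) + poly P1 z) * norm (exp (poly Q1 z))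
        \<le> norm (poly P1 z) / 2 * norm (exp (poly Q1 z))"
      using that by (simp add: norm_mult T1_def)
    then show ?thesis by (rule mult_right_le_imp_le) simp
  qed
  have "\<forall>\<^sub>F z in at_infinity. (z \<in> A \<longrightarrow>
      norm (T2 z) \<le> 1 \<or> 2 * (norm (poly P3 z) + 1) \<le> norm (T1 z) \<or> norm (T1 z) \<le> 1)
      \<and> 4 \<le> norm (poly P3 z) \<and> max \<rho>1 (max \<rho>2 \<rho>3) \<le> norm z"
    using eventually_small_value_cases[OF deg(1,2) P rays, of P3]
    unfolding A_def T1_def T2_def mem_Collect_eq
    by (intro eventually_conj eventually_poly_norm_ge[OF deg(3)] eventually_at_infinity_ge)
  then obtain \<rho> where \<rho>: "\<And>z. \<rho> \<le> norm z \<Longrightarrow> (z \<in> A \<longrightarrow>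
      norm (T2 z) \<le> 1 \<or> 2 * (norm (poly P3 z) + 1) \<le> norm (T1 z) \<or> norm (T1 z) \<le> 1)
      \<and> 4 \<le> norm (poly P3 z) \<and> max \<rho>1 (max \<rho>2 \<rho>3) \<le> norm z"
    unfolding eventually_at_infinity by blast
  define S1 where "S1 = {z. norm (T2 z) \<le> 1}"
  define S2 where "S2 = {z. 2 * (norm (poly P3 z) + 1) \<le> norm (T1 z)}"
  define S3 where "S3 = {z. norm (T1 z) \<le> 1}"
  have clS: "closed S1" "closed S2" "closed S3"
    unfolding S1_def S2_def S3_def by (intro closed_Collect_le continuous_intros contT)+
  have "closed A"
    unfolding A_def by (intro closed_Collect_le continuous_intros contT)
  moreover have "bounded D" if D: "connected D" "D \<subseteq> A - ball 0 \<rho>" for D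
  proof -
    have far: "z \<in> S1 \<union> S2 \<union> S3" "4 \<le> norm (poly P3 z)" "\<rho>1 \<le> norm z" "\<rho>2 \<le> norm z" "\<rho>3 \<le> norm z"
      "norm (T1 z + T2 z + poly P3 z) \<le> 1" if "z \<in> D" for z
    proof -
      have "\<rho> \<le> norm z" "z \<in> A" using that D(2) by auto
      then show "z \<in> S1 \<union> S2 \<union> S3" "4 \<le> norm (poly P3 z)" "\<rho>1 \<le> norm z" "\<rho>2 \<le> norm z"
          "\<rho>3 \<le> norm z" "norm (T1 z + T2 z + poly P3 z) \<le> 1"
        using \<rho>[of z] unfolding S1_def S2_def S3_def A_def by auto
    qed
    have tri: "norm t1 \<le> norm (t1 + t2 + t3) + norm t2 + norm t3"
      "norm t3 \<le> norm (t1 + t2 + t3) + norm t1 + norm t2"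
      "norm (t1 + t2) \<le> norm (t1 + t2 + t3) + norm t3"
      "norm (t1 + t3) \<le> norm (t1 + t2 + t3) + norm t2"
      "norm (t2 + t3) \<le> norm (t1 + t2 + t3) + norm t1" for t1 t2 t3 :: complex
      by norm+
    have disj: "S1 \<inter> S2 \<inter> D = {}" "S1 \<inter> S3 \<inter> D = {}" "S2 \<inter> S3 \<inter> D = {}"
      using far(2,6) tri(1)[of "T1 _" "T2 _" "poly P3 _"] tri(2)[of "poly P3 _" "T1 _" "T2 _"]
      unfolding S1_def S2_def S3_def disjoint_iff Int_iff mem_Collect_eq by (smt (verit))+
    have "D \<subseteq> S1 \<or> D \<subseteq> S2 \<union> S3"
      using connected_closedD[OF D(1), of S1 "S2 \<union> S3"] far(1) disj clS by blast
    moreover have "D \<subseteq> S2 \<or> D \<subseteq> S3" if "D \<subseteq> S2 \<union> S3"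
      using connected_closedD[OF D(1), of S2 S3] that disj clS by blast
    ultimately consider "D \<subseteq> S1" | "D \<subseteq> S2" | "D \<subseteq> S3" by blast
    then show "bounded D"
    proof cases
      case 1
      show ?thesis
      proof (rule \<rho>1[OF D(1)])
        fix z assume z: "z \<in> D"
        then have "norm (T2 z) \<le> 1" using 1 unfolding S1_def by blast
        then show "\<rho>1 \<le> norm z \<and> norm (T1 z + poly P3 z) \<le> norm (poly P3 z) / 2"
          using far(2,3,6)[OF z] tri(4)[of "T1 z" "poly P3 z" "T2 z"] by linarith
      qed
    next
      case 2
      show ?thesis
      proof (rule \<rho>3[OF D(1)], intro conjI quotient)
        fix z assume z: "z \<in> D"
        then have "2 * norm (poly P3 z) + 2 \<le> norm (T1 z)" using 2 unfolding S2_def by auto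
        moreover have "norm (T1 z + T2 z) \<le> norm (poly P3 z) + 1"
          using far(6)[OF z] tri(3)[of "T1 z" "T2 z" "poly P3 z"] by linarith
        ultimately show "norm (T1 z + T2 z) \<le> norm (T1 z) / 2"
          by linarith
      qed (rule far(5))
    next
      case 3
      show ?thesis
      proof (rule \<rho>2[OF D(1)])
        fix z assume z: "z \<in> D"
        then have "norm (T1 z) \<le> 1" using 3 unfolding S3_def by blast
        then show "\<rho>2 \<le> norm z \<and> norm (T2 z + poly P3 z) \<le> norm (poly P3 z) / 2"
          using far(2,4,6)[OF z] tri(5)[of "T2 z" "poly P3 z" "T1 z"] by linarith
      qed
    qed
  qed
  ultimately show ?thesis
    using C(2) unfolding A_def T1_def T2_def
    by (rule connected_subset_bounded_if_bounded_outside_ball[OF _ _ C(1)])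
qed

text \<open>
  In the direction in which the leading term of \<open>Q2\<close> is positive, \<open>P2 * exp Q2\<close>
  outgrows the other terms and every polynomial.
\<close>

lemma exponential_sum_not_polynomial:
  fixes P1 P2 P3 Q1 Q2 :: "complex poly"
  assumes "degree Q1 > 0" "degree Q1 < degree Q2" "P2 \<noteq> 0"
  shows "\<nexists>p. \<forall>z. poly P1 z * exp (poly Q1 z) + poly P2 z * exp (poly Q2 z) + poly P3 z = poly p z"
proof
  assume "\<exists>p. \<forall>z. poly P1 z * exp (poly Q1 z) + poly P2 z * exp (poly Q2 z) + poly P3 z = poly p z"
  then obtain p where p: "\<And>z. poly P1 z * exp (poly Q1 z) + poly P2 z * exp (poly Q2 z) + poly P3 z = poly p z"
    by blast
  define a d where "a = lead_coeff Q2" and "d = degree Q2"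
  define \<delta> where "\<delta> = norm a / 2"
  have "Q2 \<noteq> 0" using assms(2) by auto
  then have a: "a \<noteq> 0" "\<delta> > 0" by (auto simp: a_def \<delta>_def)
  have d: "d > 0" using assms(2) by (simp add: d_def)
  \<comment> \<open>The argument of \<open>u\<close> is chosen so that \<open>a * u ^ d\<close> is a positive real.\<close>
  define u where "u = rcis 1 (- Arg a / real d)"
  have "u ^ d = cis (- Arg a)"
    using d by (simp add: u_def DeMoivre2) (simp add: rcis_def)
  moreover have "a = of_real (norm a) * cis (Arg a)"
    by (metis rcis_cmod_Arg rcis_def)
  ultimately have au: "a * u ^ d = of_real (norm a)"
    by (metis (no_types, lifting) cis_mult cis_zero mult.assoc mult.right_neutral right_minus)
  have "\<forall>\<^sub>F z in at_infinity. \<not> \<delta> * norm z ^ d \<le> Re (poly Q2 z)"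
    using eventually_dominant_exponential[OF assms a(2), of P1 "P3 - p"]
  proof eventually_elim
    case (elim z)
    have "norm (poly P2 z * exp (poly Q2 z)) = norm (poly P1 z * exp (poly Q1 z) + poly (P3 - p) z)"
    proof -
      have "poly P2 z * exp (poly Q2 z) = - (poly P1 z * exp (poly Q1 z) + poly (P3 - p) z)"
        unfolding poly_diff p[of z, symmetric] by simp
      then show ?thesis by (simp only: norm_minus_cancel)
    qed
    also have "\<dots> \<le> norm (poly P1 z * exp (poly Q1 z)) + norm (poly (P3 - p) z)"
      by (rule norm_triangle_ineq)
    finally show ?case using elim unfolding d_def by linarith
  qed
  then have "\<forall>\<^sub>F z in at_infinity. \<not> \<delta> * norm z ^ d \<le> Re (poly Q2 z) \<and>
      norm (poly Q2 z - a * z ^ d) \<le> \<delta> * norm z ^ d"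
    using eventually_poly_near_leading_term[OF a(2), of Q2] unfolding a_def d_def
    by (rule eventually_conj)
  then obtain \<rho> where \<rho>: "\<And>z. \<rho> \<le> norm z \<Longrightarrow> \<not> \<delta> * norm z ^ d \<le> Re (poly Q2 z) \<and>
      norm (poly Q2 z - a * z ^ d) \<le> \<delta> * norm z ^ d"
    unfolding eventually_at_infinity by blast
  define x where "x = max 1 \<rho>"
  define z where "z = of_real x * u"
  have z: "norm z = x" "a * z ^ d = of_real (norm a * x ^ d)"
    using au by (auto simp: z_def u_def x_def norm_mult power_mult_distrib mult_ac)
  have "norm a * x ^ d - Re (poly Q2 z) \<le> \<delta> * x ^ d"
    using \<rho>[of z] complex_Re_le_cmod[of "a * z ^ d - poly Q2 z"] z
    by (simp add: x_def norm_minus_commute)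
  then have "\<delta> * x ^ d \<le> Re (poly Q2 z)"
    by (simp add: \<delta>_def field_simps)
  then show False using \<rho>[of z] z(1) by (simp add: x_def)
qed

section \<open>Existence of the Baker omitted value\<close>

lemma has_bov_exponential_sum:
  fixes P1 P2 P3 Q1 Q2 :: "complex poly"
  assumes deg: "degree Q1 > 0" "degree Q1 < degree Q2" "degree P3 > 0"
    and P: "P1 \<noteq> 0" "P2 \<noteq> 0"
    and rays: "fundamental_rays Q1 \<inter> fundamental_rays Q2 = {}"
  shows "has_bov (\<lambda>z. poly P1 z * exp (poly Q1 z) + poly P2 z * exp (poly Q2 z) + poly P3 z)"
proof (rule has_bov_if_sublevel_components_bounded[OF _ zero_less_one])
  show holo: "(\<lambda>z. poly P1 z * exp (poly Q1 z) + poly P2 z * exp (poly Q2 z) + poly P3 z) holomorphic_on UNIV"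
    by (intro holomorphic_intros)
  show "\<not> bounded {z. norm (poly P1 z * exp (poly Q1 z) + poly P2 z * exp (poly Q2 z) + poly P3 z) \<le> 1}"
    by (rule unbounded_sublevel_set[OF holo exponential_sum_not_polynomial zero_less_one]) (fact deg P)+
qed (rule connected_subset_of_small_values_bounded[OF deg P rays])

theorem theorem1p2:
  fixes Q1 Q2 P1 P2 P3 :: "complex poly"
  assumes "degree Q1 \<ge> 1" and "degree Q2 \<ge> 1" and "degree P3 \<ge> 1"
    and "P1 \<noteq> 0" and "P2 \<noteq> 0"
    and "degree Q1 \<noteq> degree Q2"
    and "fundamental_rays Q1 \<inter> fundamental_rays Q2 = {}"
  shows "has_bov (\<lambda>z. poly P1 z * exp (poly Q1 z) + poly P2 z * exp (poly Q2 z) + poly P3 z)"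
proof (cases "degree Q1 < degree Q2")
  case True
  with assms show ?thesis by (intro has_bov_exponential_sum) auto
next
  case False
  with assms have "has_bov (\<lambda>z. poly P2 z * exp (poly Q2 z) + poly P1 z * exp (poly Q1 z) + poly P3 z)"
    by (intro has_bov_exponential_sum) auto
  then show ?thesis by (simp add: add.commute)
qed

end
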